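(* Let $p>1$ ($p=\infty$ allowed), let $Q^*:=\min_{y}Q(y)$ be the optimal value of $Q$ over all (unrestricted) $y\in\mathrm{dom}(Q)$, and let $\hat y\in\mathbb{R}^n$ be arbitrary (possibly $\hat y\notin\mathrm{dom}(Q)$). If $\hat\eta<Q^*$, then every $\ell_p$-deepest cut separating $(\hat y,\hat\eta)$ from $\mathcal{E}$ is an optimality cut.
   Context: Data: $f\in\mathbb{R}^n$, $c\in\mathbb{R}^{n'}$, $b\in\mathbb{R}^m$, $A\in\mathbb{R}^{m\times n'}$, $B\in\mathbb{R}^{m\times n}$, $Y\subset\mathbb{Z}^n$. Standing assumption: the mixed-integer program $\min\{c^\top x+f^\top y: Ax+By\ge b,\ x\ge0,\ y\in Y\}$ is feasible and bounded. For $y\in\mathbb{R}^n$ let $Q(y)=f^\top y+\min\{c^\top x: Ax\ge b-By,\ x\ge0\}$, and let $\mathrm{dom}(Q)$ be the set of $y\in\mathbb{R}^n$ for which this linear program is feasible. The epigraph is $\mathcal{E}=\{(y,\eta)\in\mathbb{R}^{n+1}: y\in\mathrm{dom}(Q),\ \eta\ge Q(y)\}$. The cone of dual solutions is $\Pi=\{(\pi,\pi_0)\in\mathbb{R}^m\times\mathbb{R}:\pi^\top A\le\pi_0c^\top,\ \pi\ge0,\ \pi_0\ge0\}$. An $\ell_p$-deepest cut separating $(\hat y,\hat\eta)\notin\mathcal{E}$ from $\mathcal{E}$ is the inequality $\hat\pi^\top(b-By)+\hat\pi_0(f^\top y-\eta)\le0$ in $(y,\eta)$, where $(\hat\pi,\hat\pi_0)$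 is an optimal solution of $$\max_{(\pi,\pi_0)\in\Pi}\ \frac{\pi^\top(b-B\hat y)+\pi_0(f^\top\hat y-\hat\eta)}{\|(\pi^\top B-\pi_0f^\top,\ \pi_0)\|_p}$$ (only points with nonzero denominator are considered). Such a cut is an optimality cut if $\hat\pi_0>0$ and a feasibility cut if $\hat\pi_0=0$. *)

theory Defs
  imports "HOL-Analysis.Analysis"
begin

text \<open>
  The order on \<^typ>\<open>real ^ 'n\<close> is componentwise, \<^term>\<open>A *v x\<close> is the matrix-vector product and
  \<^term>\<open>\<pi> v* A\<close> is the row vector \<open>\<pi>\<^sup>T A\<close>.
\<close>

definition mip_feasible ::
  "real ^ 'k ^ 'm \<Rightarrow> real ^ 'n ^ 'm \<Rightarrow> real ^ 'm \<Rightarrow> (real ^ 'n) set \<Rightarrow> ((real ^ 'k) \<times> (real ^ 'n)) set"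
  where "mip_feasible A B b Y = {(x, y). b \<le> A *v x + B *v y \<and> 0 \<le> x \<and> y \<in> Y}"

definition sub_feasible ::
  "real ^ 'k ^ 'm \<Rightarrow> real ^ 'n ^ 'm \<Rightarrow> real ^ 'm \<Rightarrow> real ^ 'n \<Rightarrow> (real ^ 'k) set"
  where "sub_feasible A B b y = {x. b - B *v y \<le> A *v x \<and> 0 \<le> x}"

definition dom_Q ::
  "real ^ 'k ^ 'm \<Rightarrow> real ^ 'n ^ 'm \<Rightarrow> real ^ 'm \<Rightarrow> (real ^ 'n) set"
  where "dom_Q A B b = {y. sub_feasible A B b y \<noteq> {}}"

text \<open>
  Optimal values of linear programs are infima in \<^typ>\<open>ereal\<close>: \<open>\<infinity>\<close> if the program is infeasible,
  \<open>-\<infinity>\<close> if it is unbounded; a finite optimal value of a linear program is attained.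
\<close>

definition Q_fun ::
  "real ^ 'k ^ 'm \<Rightarrow> real ^ 'n ^ 'm \<Rightarrow> real ^ 'm \<Rightarrow> real ^ 'k \<Rightarrow> real ^ 'n \<Rightarrow> real ^ 'n \<Rightarrow> ereal"
  where "Q_fun A B b c f y = ereal (f \<bullet> y) + (INF x\<in>sub_feasible A B b y. ereal (c \<bullet> x))"

definition Q_star ::
  "real ^ 'k ^ 'm \<Rightarrow> real ^ 'n ^ 'm \<Rightarrow> real ^ 'm \<Rightarrow> real ^ 'k \<Rightarrow> real ^ 'n \<Rightarrow> ereal"
  where "Q_star A B b c f = (INF y\<in>dom_Q A B b. Q_fun A B b c f y)"

definition epigraph_Q ::
  "real ^ 'k ^ 'm \<Rightarrow> real ^ 'n ^ 'm \<Rightarrow> real ^ 'm \<Rightarrow> real ^ 'k \<Rightarrow> real ^ 'n \<Rightarrow> ((real ^ 'n) \<times> real) set"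
  where "epigraph_Q A B b c f = {(y, \<eta>). y \<in> dom_Q A B b \<and> Q_fun A B b c f y \<le> ereal \<eta>}"

definition dual_cone :: "real ^ 'k ^ 'm \<Rightarrow> real ^ 'k \<Rightarrow> ((real ^ 'm) \<times> real) set"
  where "dual_cone A c = {(\<pi>, \<pi>0). \<pi> v* A \<le> \<pi>0 *\<^sub>R c \<and> 0 \<le> \<pi> \<and> 0 \<le> \<pi>0}"

text \<open>For \<^typ>\<open>(real ^ 'n) \<times> real\<close>, \<^const>\<open>Basis\<close> is the standard basis of \<open>\<real>\<^sup>n\<^sup>+\<^sup>1\<close>.\<close>

definition lp_norm :: "ereal \<Rightarrow> 'a::euclidean_space \<Rightarrow> real"
  where "lp_norm p z =
    (if p = \<infinity> then infnorm z
     else (\<Sum>i\<in>Basis. \<bar>z \<bullet> i\<bar> powr real_of_ereal p) powr (1 / real_of_ereal p))"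

text \<open>
  A pair \<open>(\<pi>, \<pi>0)\<close> of multipliers stands for the cut \<open>cut_lhs B b f (\<pi>, \<pi>0) (y, \<eta>) \<le> 0\<close>,
  an inequality in \<open>(y, \<eta>)\<close>.
\<close>

definition cut_lhs ::
  "real ^ 'n ^ 'm \<Rightarrow> real ^ 'm \<Rightarrow> real ^ 'n \<Rightarrow> (real ^ 'm) \<times> real \<Rightarrow> (real ^ 'n) \<times> real \<Rightarrow> real"
  where "cut_lhs B b f = (\<lambda>(\<pi>, \<pi>0) (y, \<eta>). \<pi> \<bullet> (b - B *v y) + \<pi>0 * (f \<bullet> y - \<eta>))"

definition cut_norm ::
  "ereal \<Rightarrow> real ^ 'n ^ 'm \<Rightarrow> real ^ 'n \<Rightarrow> (real ^ 'm) \<times> real \<Rightarrow> real"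
  where "cut_norm p B f = (\<lambda>(\<pi>, \<pi>0). lp_norm p (\<pi> v* B - \<pi>0 *\<^sub>R f, \<pi>0))"

definition deepest_cut ::
  "real ^ 'k ^ 'm \<Rightarrow> real ^ 'n ^ 'm \<Rightarrow> real ^ 'm \<Rightarrow> real ^ 'k \<Rightarrow> real ^ 'n \<Rightarrow> ereal \<Rightarrow>
    (real ^ 'n) \<times> real \<Rightarrow> (real ^ 'm) \<times> real \<Rightarrow> bool"
  where "deepest_cut A B b c f p z \<kappa> \<longleftrightarrow>
    z \<notin> epigraph_Q A B b c f \<and>
    is_arg_max (\<lambda>\<kappa>'. cut_lhs B b f \<kappa>' z / cut_norm p B f \<kappa>')
      (\<lambda>\<kappa>'. \<kappa>' \<in> dual_cone A c \<and> cut_norm p B f \<kappa>' \<noteq> 0) \<kappa>"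

definition optimality_cut :: "'a \<times> real \<Rightarrow> bool"
  where "optimality_cut = (\<lambda>(\<pi>, \<pi>0). \<pi>0 > 0)"

end

theory Submission
  imports Defs
begin

text \<open>
  Suppose \<open>\<pi>0 = 0\<close> in a deepest cut. Since \<open>\<eta> < Q\<^sup>*\<close>, linear programming duality for the joint
  program in \<open>(x, y)\<close> with \<open>y\<close> free gives \<open>(\<pi>', 1)\<close> in the dual cone with \<open>\<pi>'\<^sup>T B = f\<^sup>T\<close> and
  \<open>\<pi>'\<^sup>T b > \<eta>\<close>. Adding \<open>t (\<pi>', 1)\<close> to \<open>(\<pi>, 0)\<close> raises the numerator of the objective linearly in
  \<open>t\<close>, whereas it changes only the last coordinate of the vector in the denominator, from \<open>0\<close> to
  \<open>t\<close>; as \<open>p > 1\<close>, the norm grows by \<open>o(t)\<close> only. So the ratio increases for small \<open>t > 0\<close>.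
\<close>

section \<open>Duality\<close>

text \<open>A finitely generated cone is closed, so a hyperplane strictly separates \<open>z\<close>
  from it. Invariance of the cone under scaling then moves this hyperplane to the origin.\<close>

lemma farkas_convex_cone_hull:
  fixes S :: "'a::euclidean_space set"
  assumes "finite S" and "z \<notin> convex_cone hull S"
  obtains a where "a \<bullet> z < 0" and "\<And>s. s \<in> S \<Longrightarrow> 0 \<le> a \<bullet> s"
proof -
  obtain a d where az: "a \<bullet> z < d" and ad: "\<And>x. x \<in> convex_cone hull S \<Longrightarrow> d < a \<bullet> x"
    using separating_hyperplane_closed_point[OF convex_convex_cone_hull
        closed_convex_cone_hull[OF assms(1)] assms(2)] by metis
  have d: "d < 0"
    using ad[OF convex_cone_hull_contains_0] by simp
  have "0 \<le> a \<bullet> s" if "s \<in> S" for s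
  proof (rule ccontr)
    assume neg: "\<not> 0 \<le> a \<bullet> s"
    \<comment> \<open>If \<open>a\<close> were negative on \<open>s\<close>, this multiple of
      \<open>s\<close> would lie in the cone and have \<open>a\<close>-value exactly
      \<open>d\<close>.\<close>
    have "(d / (a \<bullet> s)) *\<^sub>R s \<in> convex_cone hull S"
      using that neg d by (intro convex_cone_hull_mul hull_inc) (auto simp: zero_le_divide_iff)
    from ad[OF this] show False
      using neg by simp
  qed
  moreover have "a \<bullet> z < 0"
    using az d by simp
  ultimately show ?thesis
    using that by metis
qed

text \<open>The multiplier exists iff \<open>(c, f, - q)\<close> lies in a finitely generated cone.
  A vector separating it from that cone would yield a feasible point with objective value below
  \<open>q\<close>.\<close>

lemma lp_strong_duality:
  fixes A :: "real ^ 'k ^ 'm" and B :: "real ^ 'n ^ 'm" and b :: "real ^ 'm"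
    and c x0 :: "real ^ 'k" and f y0 :: "real ^ 'n"
  assumes feas: "b \<le> A *v x0 + B *v y0" "0 \<le> x0"
    and lower: "\<And>x y. \<lbrakk>b \<le> A *v x + B *v y; 0 \<le> x\<rbrakk> \<Longrightarrow> q \<le> c \<bullet> x + f \<bullet> y"
  obtains \<pi> where "0 \<le> \<pi>" "\<pi> v* A \<le> c" "\<pi> v* B = f" "q \<le> \<pi> \<bullet> b"
proof -
  \<comment> \<open>Generators: the constraint rows paired with \<open>- b\<close>, and slack
    directions for the first and last blocks. The middle block gets no slack because
    \<open>y\<close> is free, whence the equation \<open>\<pi> v* B = f\<close>.\<close>
  define G where "G = range (\<lambda>i. (axis i 1 v* A, axis i 1 v* B, - (b $ i)))
    \<union> range (\<lambda>j. (axis j 1, 0, 0)) \<union> {(0 :: real ^ 'k, 0 :: real ^ 'n, 1 :: real)}"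
  \<comment> \<open>The cone of \<open>G\<close> with its coefficients made explicit: membership of
    \<open>(c, f, - q)\<close> is the conclusion.\<close>
  define K where "K = {(u, v, r). \<exists>\<pi>\<ge>0. \<pi> v* A \<le> u \<and> \<pi> v* B = v \<and> - (\<pi> \<bullet> b) \<le> r}"
  have K_zero: "0 \<in> K"
    by (auto simp: K_def zero_prod_def intro!: exI[of _ 0])
  have K_add: "x + y \<in> K" if "x \<in> K" "y \<in> K" for x y
  proof -
    obtain u v r \<pi> where
      "x = (u, v, r)" "0 \<le> \<pi>" "\<pi> v* A \<le> u" "\<pi> v* B = v" "- (\<pi> \<bullet> b) \<le> r"
      using \<open>x \<in> K\<close> by (auto simp: K_def)
    moreover obtain u' v' r' \<pi>' where
      "y = (u', v', r')" "0 \<le> \<pi>'" "\<pi>' v* A \<le> u'" "\<pi>' v* B = v'" "- (\<pi>' \<bullet> b) \<le> r'"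
      using \<open>y \<in> K\<close> by (auto simp: K_def)
    ultimately show ?thesis
      by (auto simp: K_def vector_matrix_left_distrib inner_add_left add_mono
          intro!: exI[of _ "\<pi> + \<pi>'"])
  qed
  have K_scale: "s *\<^sub>R x \<in> K" if "x \<in> K" "0 \<le> s" for x s
  proof -
    obtain u v r \<pi> where
      *: "x = (u, v, r)" "0 \<le> \<pi>" "\<pi> v* A \<le> u" "\<pi> v* B = v" "- (\<pi> \<bullet> b) \<le> r"
      using \<open>x \<in> K\<close> by (auto simp: K_def)
    have "- (s * (\<pi> \<bullet> b)) \<le> s * r"
      using mult_left_mono[OF *(5) that(2)] by simp
    with * that(2) show ?thesis
      by (auto simp: K_def scaleR_vector_matrix_assoc less_eq_vec_def mult_left_mono
          intro!: exI[of _ "s *\<^sub>R \<pi>"])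
  qed
  have "convex_cone K"
    unfolding convex_cone_iff using K_zero K_add K_scale by blast
  moreover have "G \<subseteq> K"
  proof -
    have "(axis i 1 v* A, axis i 1 v* B, - (b $ i)) \<in> K" for i
      unfolding K_def
    proof (clarsimp, intro exI conjI)
      show "0 \<le> (axis i 1 :: real ^ 'm)"
        by (simp add: less_eq_vec_def axis_def)
    qed (auto simp: inner_axis')
    moreover have "(axis j 1, 0, 0) \<in> K" "(0, 0, 1) \<in> K" for j
      by (auto simp: K_def less_eq_vec_def axis_def intro!: exI[of _ 0])
    ultimately show ?thesis
      unfolding G_def by blast
  qed
  ultimately have hull: "convex_cone hull G \<subseteq> K"
    by (intro hull_minimal)
  have "(c, f, - q) \<in> convex_cone hull G"
  proof (rule ccontr)
    assume notin: "(c, f, - q) \<notin> convex_cone hull G"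
    have "finite G"
      by (simp add: G_def)
    then obtain a where neg: "a \<bullet> (c, f, - q) < 0" and nonneg: "\<And>g. g \<in> G \<Longrightarrow> 0 \<le> a \<bullet> g"
      using farkas_convex_cone_hull[OF _ notin] by blast
    \<comment> \<open>The separating vector is a point of the homogenized primal program, with
      \<open>t\<close> scaling \<open>b\<close> and objective value below
      \<open>t * q\<close>.\<close>
    obtain x y t where a: "a = (x, y, t)"
      by (cases a) auto
    have "0 \<le> (A *v x + B *v y - t *\<^sub>R b) $ i" for i
    proof -
      have "0 \<le> (axis i 1 v* A) \<bullet> x + (axis i 1 v* B) \<bullet> y - t * b $ i"
        using nonneg[of "(axis i 1 v* A, axis i 1 v* B, - (b $ i))"]
        by (simp add: G_def a inner_commute)
      then show ?thesis
        by (simp add: dot_lmul_matrix inner_axis')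
    qed
    then have feas_ray: "t *\<^sub>R b \<le> A *v x + B *v y"
      by (simp add: less_eq_vec_def)
    have "0 \<le> x $ j" for j
      using nonneg[of "(axis j 1, 0, 0)"] by (simp add: G_def a inner_axis)
    then have x: "0 \<le> x"
      by (simp add: less_eq_vec_def)
    have t: "0 \<le> t"
      using nonneg[of "(0, 0, 1)"] by (simp add: G_def a)
    define v where "v = c \<bullet> x + f \<bullet> y - t * q"
    have v: "v < 0"
      using neg by (simp add: v_def a inner_commute)
    \<comment> \<open>If \<open>t = 0\<close>, then \<open>(x, y)\<close> is only a recession direction; adding a small multiple of the
      feasible point \<open>(x0, y0)\<close> makes the homogenizing coordinate positive.\<close>
    define w where "w = c \<bullet> x0 + f \<bullet> y0 - q"
    \<comment> \<open>Chosen so that \<open>e * w\<close> is at most \<open>- v / 2\<close>; the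
      summand 1 keeps the denominator positive.\<close>
    define e where "e = - v / (2 * (\<bar>w\<bar> + 1))"
    have e: "0 < e"
      unfolding e_def using v by (intro divide_pos_pos) auto
    have "e * w \<le> e * (\<bar>w\<bar> + 1)"
      using e by simp
    also have "\<dots> = - v / 2"
      unfolding e_def by (simp add: divide_simps)
    finally have less: "v + e * w < 0"
      using v by simp
    define s where "s = t + e"
    have s: "0 < s"
      using t e by (simp add: s_def)
    define x1 where "x1 = (1 / s) *\<^sub>R (x + e *\<^sub>R x0)"
    define y1 where "y1 = (1 / s) *\<^sub>R (y + e *\<^sub>R y0)"
    have eq: "A *v x1 + B *v y1
        = (1 / s) *\<^sub>R ((A *v x + B *v y) + e *\<^sub>R (A *v x0 + B *v y0))"
      by (simp add: x1_def y1_def matrix_vector_mult_scaleR matrix_vector_right_distrib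
          scaleR_right_distrib)
    have "b = (1 / s) *\<^sub>R (t *\<^sub>R b + e *\<^sub>R b)"
      using s by (simp add: s_def flip: scaleR_left_distrib)
    also have "\<dots> \<le> A *v x1 + B *v y1"
    proof -
      have "(1 / s) *\<^sub>R (t *\<^sub>R b + e *\<^sub>R b) $ i \<le> (A *v x1 + B *v y1) $ i" for i
        unfolding eq vector_scaleR_component vector_add_component real_scaleR_def
        using feas_ray feas(1) s e
        by (intro mult_left_mono add_mono) (auto simp: less_eq_vec_def)
      then show ?thesis
        by (simp add: less_eq_vec_def)
    qed
    finally have "b \<le> A *v x1 + B *v y1" .
    moreover have "0 \<le> x1"
      using x feas(2) e s by (simp add: x1_def less_eq_vec_def)
    ultimately have "q \<le> c \<bullet> x1 + f \<bullet> y1"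
      by (rule lower)
    then have "q * s \<le> (c \<bullet> x1 + f \<bullet> y1) * s"
      using s by simp
    also have "\<dots> = c \<bullet> (x + e *\<^sub>R x0) + f \<bullet> (y + e *\<^sub>R y0)"
      using s by (simp add: x1_def y1_def inner_add_right divide_simps)
    finally have "0 \<le> v + e * w"
      by (simp add: v_def w_def s_def inner_add_right algebra_simps)
    with less show False
      by simp
  qed
  with hull have "(c, f, - q) \<in> K"
    by blast
  then show ?thesis
    using that by (auto simp: K_def)
qed

text \<open>Supplies the direction in which a feasibility cut is perturbed.\<close>

lemma dual_multiplier_above:
  fixes A :: "real ^ 'k ^ 'm" and B :: "real ^ 'n ^ 'm"
  assumes "dom_Q A B b \<noteq> {}" and "ereal \<eta> < Q_star A B b c f"
  obtains \<pi> where "(\<pi>, 1) \<in> dual_cone A c" "\<pi> v* B = f" "\<eta> < \<pi> \<bullet> b"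
proof -
  obtain x0 y0 where feas: "b \<le> A *v x0 + B *v y0" "0 \<le> x0"
    using assms(1) by (auto simp: dom_Q_def sub_feasible_def algebra_simps)
  \<comment> \<open>\<open>Q_star\<close> is an extended real and duality takes a real lower bound;
    a \<open>q\<close> strictly above \<eta> also keeps the final inequality strict.\<close>
  obtain q where q: "ereal \<eta> < ereal q" "ereal q < Q_star A B b c f"
    using ereal_dense2[OF assms(2)] by blast
  have "q \<le> c \<bullet> x + f \<bullet> y" if "b \<le> A *v x + B *v y" "0 \<le> x" for x y
  proof -
    have x: "x \<in> sub_feasible A B b y"
      using that by (simp add: sub_feasible_def algebra_simps)
    then have "Q_star A B b c f \<le> Q_fun A B b c f y"
      unfolding Q_star_def by (intro INF_lower) (auto simp: dom_Q_def)
    also have "\<dots> \<le> ereal (f \<bullet> y) + ereal (c \<bullet> x)"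
      unfolding Q_fun_def by (intro add_left_mono INF_lower x)
    finally show ?thesis
      using less_le_trans[OF q(2)] by fastforce
  qed
  with feas obtain \<pi> where "0 \<le> \<pi>" "\<pi> v* A \<le> c" "\<pi> v* B = f" "q \<le> \<pi> \<bullet> b"
    by (rule lp_strong_duality)
  with q(1) show ?thesis
    by (intro that[of \<pi>]) (auto simp: dual_cone_def)
qed

section \<open>Growth of the norm in a coordinate direction\<close>

lemma lp_norm_nonneg: "0 \<le> lp_norm p z"
  by (simp add: lp_norm_def infnorm_pos_le)

lemma lp_norm_infinity_Pair:
  fixes u :: "'a::euclidean_space"
  shows "lp_norm \<infinity> (u, t :: real) = max (infnorm u) \<bar>t\<bar>"
proof -
  have "(\<lambda>i. \<bar>(u, t) \<bullet> i\<bar>) ` Basis = insert \<bar>t\<bar> ((\<lambda>i. \<bar>u \<bullet> i\<bar>) ` Basis)"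
    by (force simp: Basis_prod_def)
  then show ?thesis
    by (simp add: lp_norm_def infnorm_Max max.commute)
qed

lemma lp_norm_ereal_Pair:
  fixes u :: "'a::euclidean_space"
  shows "lp_norm (ereal r) (u, t :: real)
    = ((\<Sum>i\<in>Basis. \<bar>u \<bullet> i\<bar> powr r) + \<bar>t\<bar> powr r) powr (1 / r)"
proof -
  have "(\<Sum>i\<in>Basis. \<bar>(u, t) \<bullet> i\<bar> powr r)
      = (\<Sum>i\<in>(\<lambda>u. (u, 0)) ` Basis. \<bar>(u, t) \<bullet> i\<bar> powr r) + (\<Sum>i\<in>Pair 0 ` Basis. \<bar>(u, t) \<bullet> i\<bar> powr r)"
    unfolding Basis_prod_def by (rule sum.union_disjoint) auto
  also have "\<dots> = (\<Sum>i\<in>Basis. \<bar>u \<bullet> i\<bar> powr r) + \<bar>t\<bar> powr r"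
    by (simp add: sum.reindex inj_on_def)
  finally show ?thesis
    by (simp add: lp_norm_def)
qed

lemma lp_norm_Pair_zero_one:
  assumes "1 < p"
  shows "lp_norm p (0 :: 'a::euclidean_space, 1 :: real) = 1"
  using assms by (cases p) (auto simp: lp_norm_infinity_Pair lp_norm_ereal_Pair infnorm_0)

lemma lp_norm_Pair_pos:
  fixes u :: "'a::euclidean_space"
  assumes "1 < p" and "0 < t"
  shows "0 < lp_norm p (u, t :: real)"
proof (cases p)
  case (real r)
  have "0 < (\<Sum>i\<in>Basis. \<bar>u \<bullet> i\<bar> powr r) + \<bar>t\<bar> powr r"
    using assms(2) by (intro add_nonneg_pos sum_nonneg) auto
  then show ?thesis
    by (simp add: real lp_norm_ereal_Pair)
qed (use assms in \<open>auto simp: lp_norm_infinity_Pair\<close>)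

text \<open>For p > 1 the norm has derivative 0 at \<open>t = 0\<close> along the last coordinate,
  since the rest of the vector is nonzero; hence any slope \<open>e > 0\<close> suffices for some
  \<open>t\<close>.\<close>

lemma lp_norm_Pair_small_increment:
  fixes u :: "'a::euclidean_space"
  assumes p: "1 < p" and pos: "0 < lp_norm p (u, 0 :: real)" and e: "0 < e"
  obtains t :: real where "0 < t" and "lp_norm p (u, t) \<le> lp_norm p (u, 0 :: real) + e * t"
proof (cases p)
  case PInf
  \<comment> \<open>The maximum norm does not change at all until \<open>t\<close> exceeds
    \<open>infnorm u\<close>.\<close>
  show ?thesis
    using pos e by (intro that[of "infnorm u"]) (auto simp: PInf lp_norm_infinity_Pair)
next
  case (real r)
  then have r: "1 < r"
    using p by simp
  define S where "S = (\<Sum>i\<in>Basis. \<bar>u \<bullet> i\<bar> powr r)"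
  define D where "D = lp_norm p (u, 0 :: real)"
  have "0 \<le> S"
    unfolding S_def by (intro sum_nonneg) auto
  then have D: "0 < D" "D powr r = S"
    using pos r by (auto simp: D_def real lp_norm_ereal_Pair S_def powr_powr)
  \<comment> \<open>\<open>s\<close> solves \<open>s\<^sup>r = e s\<close>, so that \<open>D\<^sup>r + (D s)\<^sup>r = D\<^sup>r (1 + e s) \<le> (D (1 + e s))\<^sup>r\<close>.\<close>
  define s where "s = e powr (1 / (r - 1))"
  have s: "0 < s" and "s powr (r - 1) = e"
    using e r by (auto simp: s_def powr_powr)
  then have sr: "s powr r = e * s"
    using powr_add[of s "r - 1" 1] by simp
  have "S + (D * s) powr r = D powr r * (1 + e * s)"
    using D s sr by (simp add: powr_mult algebra_simps)
  also have "\<dots> \<le> D powr r * (1 + e * s) powr r"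
    using powr_mono[of 1 r "1 + e * s"] r e s by (intro mult_left_mono) auto
  also have "\<dots> = (D * (1 + e * s)) powr r"
    using D e s by (simp add: powr_mult)
  finally have "(S + (D * s) powr r) powr (1 / r) \<le> ((D * (1 + e * s)) powr r) powr (1 / r)"
    using \<open>0 \<le> S\<close> r by (intro powr_mono2) auto
  also have "\<dots> = D + e * (D * s)"
    using D e s r by (simp add: powr_powr algebra_simps)
  finally have "lp_norm p (u, D * s) \<le> D + e * (D * s)"
    using D s by (simp add: real lp_norm_ereal_Pair S_def)
  then show ?thesis
    using that[of "D * s"] D s by (simp add: D_def)
qed (use p in auto)

section \<open>Perturbing a feasibility cut\<close>

theorem proposition4:
  fixes A :: "real ^ 'k ^ 'm" and B :: "real ^ 'n ^ 'm" and b :: "real ^ 'm"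
    and c :: "real ^ 'k" and f :: "real ^ 'n" and Y :: "(real ^ 'n) set"
    and p :: ereal and y_hat :: "real ^ 'n" and eta_hat :: real
    and \<kappa> :: "(real ^ 'm) \<times> real"
  assumes "Y \<subseteq> {y. \<forall>i. y $ i \<in> \<int>}"
    and "mip_feasible A B b Y \<noteq> {}"
    and "bdd_below ((\<lambda>(x, y). c \<bullet> x + f \<bullet> y) ` mip_feasible A B b Y)"
    and "1 < p"
    and "ereal eta_hat < Q_star A B b c f"
    and "deepest_cut A B b c f p (y_hat, eta_hat) \<kappa>"
  shows "optimality_cut \<kappa>"
proof (rule ccontr)
  assume not_opt: "\<not> optimality_cut \<kappa>"
  define N where "N = (\<lambda>\<kappa>. cut_lhs B b f \<kappa> (y_hat, eta_hat))"
  have \<kappa>: "\<kappa> \<in> dual_cone A c" "cut_norm p B f \<kappa> \<noteq> 0"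
    and best: "\<And>\<kappa>'. \<lbrakk>\<kappa>' \<in> dual_cone A c; cut_norm p B f \<kappa>' \<noteq> 0\<rbrakk>
      \<Longrightarrow> N \<kappa>' / cut_norm p B f \<kappa>' \<le> N \<kappa> / cut_norm p B f \<kappa>"
    using assms(6) by (auto simp: deepest_cut_def is_arg_max_linorder N_def)
  obtain \<pi> where \<pi>: "\<kappa> = (\<pi>, 0)"
    using not_opt \<kappa>(1) by (cases \<kappa>) (auto simp: optimality_cut_def dual_cone_def)
  have \<pi>_dual: "0 \<le> \<pi>" "\<pi> v* A \<le> 0"
    using \<kappa>(1) by (auto simp: \<pi> dual_cone_def)
  define D where "D = lp_norm p (\<pi> v* B, 0 :: real)"
  have norm_\<kappa>: "cut_norm p B f \<kappa> = D"
    by (simp add: \<pi> cut_norm_def D_def)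
  then have D: "0 < D"
    using \<kappa>(2) lp_norm_nonneg[of p "(\<pi> v* B, 0 :: real)"] by (simp add: D_def)
  \<comment> \<open>The \<open>y\<close>-part of a feasible point of the mixed-integer program lies
    in the domain of Q.\<close>
  have "dom_Q A B b \<noteq> {}"
    using assms(2) by (fastforce simp: mip_feasible_def dom_Q_def sub_feasible_def algebra_simps)
  then obtain \<pi>' where \<pi>': "(\<pi>', 1) \<in> dual_cone A c" "\<pi>' v* B = f" "eta_hat < \<pi>' \<bullet> b"
    using assms(5) by (rule dual_multiplier_above)
  have f_inner: "f \<bullet> y = \<pi>' \<bullet> (B *v y)" for y
    using \<pi>'(2) dot_lmul_matrix by metis
  define \<delta> where "\<delta> = \<pi>' \<bullet> b - eta_hat"
  have \<delta>: "0 < \<delta>"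
    using \<pi>'(3) by (simp add: \<delta>_def)
  \<comment> \<open>As \<open>\<pi>' v* B = f\<close>, the terms in \<open>y\<close> cancel: this
    cut is horizontal, and its violation is the same at every \<open>y_hat\<close>.\<close>
  have "N (\<pi>', 1) = \<delta>"
    by (simp add: N_def cut_lhs_def \<delta>_def f_inner inner_diff_right)
  moreover have "cut_norm p B f (\<pi>', 1) = 1"
    using assms(4) by (simp add: cut_norm_def \<pi>'(2) lp_norm_Pair_zero_one)
  ultimately have "\<delta> \<le> N \<kappa> / D"
    using best[OF \<pi>'(1)] norm_\<kappa> by simp
  \<comment> \<open>Comparison with the horizontal cut makes the best ratio positive, so that
    bounding the norm from above is useful below.\<close>
  then have N: "0 < N \<kappa>"
    using \<delta> D by (smt (verit) divide_nonpos_pos)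
  \<comment> \<open>With this slope, norm growth costs at most
    \<open>N \<kappa> * e * t = t * \<delta> * D / 2\<close>, half of the gain
    \<open>t * \<delta> * D\<close> in the cross-multiplied comparison.\<close>
  define e where "e = D * \<delta> / (2 * N \<kappa>)"
  have e: "0 < e"
    using D \<delta> N by (simp add: e_def)
  obtain t where t: "0 < t" and norm_le: "lp_norm p (\<pi> v* B, t) \<le> D + e * t"
    using lp_norm_Pair_small_increment[OF assms(4) D[unfolded D_def] e] by (auto simp: D_def)
  define \<kappa>' where "\<kappa>' = (\<pi> + t *\<^sub>R \<pi>', t)"
  have "(\<pi> + t *\<^sub>R \<pi>') v* A = \<pi> v* A + t *\<^sub>R (\<pi>' v* A)"
    by (simp add: vector_matrix_left_distrib scaleR_vector_matrix_assoc)
  also have "\<dots> \<le> 0 + t *\<^sub>R c"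
    using \<pi>_dual(2) \<pi>'(1) t
    by (intro add_mono) (auto simp: dual_cone_def less_eq_vec_def mult_left_mono)
  finally have mem: "\<kappa>' \<in> dual_cone A c"
    using \<pi>_dual(1) \<pi>'(1) t by (auto simp: \<kappa>'_def dual_cone_def less_eq_vec_def)
  \<comment> \<open>The added \<open>t *\<^sub>R (\<pi>' v* B)\<close> cancels against
    \<open>t *\<^sub>R f\<close>, so only the last coordinate moves.\<close>
  have norm_\<kappa>': "cut_norm p B f \<kappa>' = lp_norm p (\<pi> v* B, t)"
    by (simp add: \<kappa>'_def cut_norm_def vector_matrix_left_distrib scaleR_vector_matrix_assoc \<pi>'(2))
  have pos: "0 < lp_norm p (\<pi> v* B, t)"
    using assms(4) t by (rule lp_norm_Pair_pos)
  have N_\<kappa>': "N \<kappa>' = N \<kappa> + t * \<delta>"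
    by (simp add: N_def \<kappa>'_def \<pi> cut_lhs_def \<delta>_def f_inner inner_diff_right inner_add_left
        algebra_simps)
  have "(N \<kappa> + t * \<delta>) / lp_norm p (\<pi> v* B, t) \<le> N \<kappa> / D"
    using best[OF mem] pos by (simp add: norm_\<kappa> norm_\<kappa>' N_\<kappa>')
  then have "(N \<kappa> + t * \<delta>) * D \<le> N \<kappa> * lp_norm p (\<pi> v* B, t)"
    using pos D by (simp add: field_simps)
  also have "\<dots> \<le> N \<kappa> * (D + e * t)"
    using norm_le N by simp
  also have "\<dots> = N \<kappa> * D + t * \<delta> * D / 2"
    using N by (simp add: e_def field_simps)
  finally have "t * \<delta> * D \<le> 0"
    by (simp add: algebra_simps)
  moreover have "0 < t * \<delta> * D"
    using t \<delta> D by simp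
  ultimately show False
    by simp
qed

end
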